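(* Let $(X,d,m)$ be a compact metric measure space such that $\theta^*(x)<0$ for all $x\in X$. Then the group $\operatorname{Iso}(X,d,m)$ is finite.
   Context: A metric measure space $(X,d,m)$ is a complete separable metric space $(X,d)$ with a Borel $\sigma$-finite measure $m$ on $X$ which is finite on bounded sets. $\operatorname{Iso}(X,d,m)$ is the group of isometries $\phi$ of $(X,d)$ that preserve $m$, i.e. $\phi_\# m=m$, where $\phi_\#m(A)=m(\phi^{-1}(A))$. $P_2(X)$ is the set of Borel probability measures $\mu$ on $X$ with $\int_X d^2(x_0,x)\,d\mu(x)<\infty$ for some $x_0\in X$, equipped with the 2-Wasserstein distance $W(\mu,\nu)=\left(\inf_\pi\int_{X\times X}d^2(x,y)\,d\pi(x,y)\right)^{1/2}$, the infimum being over Borel probability measures $\pi$ on $X\times X$ with marginals $\mu$ and $\nu$. The entropy functional $\operatorname{Ent}_m:P_2(X)\to\mathbb R\cup\{+\infty\}$ is $\operatorname{Ent}_m(\mu)=\int_X\rho\log\rho\,dm$ if $\mu=\rho m$, and $+\infty$ otherwise. Metric gradient flow: for a function $E:Y\to\mathbb R\cup\{+\infty\}$ on a metric space $(Y,d_Y)$, the descending slope is $|D^-E|(y)=\limsup_{z\to y}\frac{[E(z)-E(y)]^-}{d_Y(z,y)}$, and a metric gradient flow of $E$ is a locally absolutely continuous curve $(\mu_t)$ in $Y$ such that for all $t\ge0$ $$E(\mu_0)=E(\mu_t)+\frac12\int_0^t|\mu_s'|^2\,ds+\frac12\int_0^t|D^-E|^2(\mu_s)\,ds,\qquad |\mu_t'|=\lim_{s\to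 t}\frac{d_Y(\mu_s,\mu_t)}{|s-t|}.$$ If $E(\mu_0)=+\infty$, this is understood as: $(\mu_t)_{t\ge0}$ is continuous on $[0,\infty)$, locally absolutely continuous on $(0,\infty)$, $E(\mu_t)<\infty$ for $t>0$, and the corresponding identity holds between any two times $0<s\le t$. $\mathcal H_t$ denotes the metric gradient flow of $\operatorname{Ent}_m$ on $(P_2(X),W)$, and $(\mathcal H_t\delta_x)_{t\ge0}$ is the one starting at the Dirac measure $\delta_x$; it is assumed (implicitly, as part of $\theta^*$ being defined) that for every $x\in X$ this flow exists and is unique. For $x\ne y$ in $X$, $\theta^+(x,y)=-\liminf_{t\to0+}\frac1t\log\big(W(\mathcal H_t\delta_x,\mathcal H_t\delta_y)/d(x,y)\big)$, and $\theta^*(x)=\limsup_{y,z\to x}\theta^+(y,z)$, i.e. $\theta^*(x)=\inf_{r>0}\sup\{\theta^+(y,z): y,z\in B_r(x),\ y\neq z\}$. *)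

theory Defs
  imports "HOL-Probability.Probability"
begin

section \<open>Metric measure spaces and their isometries\<close>

text \<open>
  The underlying complete separable metric space is the universe of a type of class
  \<^class>\<open>polish_space\<close>.
\<close>

definition metric_measure_space :: "'a::polish_space measure \<Rightarrow> bool" where
  "metric_measure_space m \<longleftrightarrow>
     sets m = sets borel \<and> sigma_finite_measure m \<and>
     (\<forall>A\<in>sets borel. bounded A \<longrightarrow> emeasure m A < \<infinity>)"

text \<open>The carrier of the group \<open>Iso(X,d,m)\<close>, whose operation is composition.\<close>

definition Iso :: "'a::polish_space measure \<Rightarrow> ('a \<Rightarrow> 'a) set" where
  "Iso m = {\<phi>. bij \<phi> \<and> (\<forall>x y. dist (\<phi> x) (\<phi> y) = dist x y) \<and> distr m borel \<phi> = m}"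


section \<open>Wasserstein space and entropy\<close>

definition P2 :: "'a::polish_space measure set" where
  "P2 = {\<mu>. prob_space \<mu> \<and> sets \<mu> = sets borel \<and>
            (\<exists>x0. (\<integral>\<^sup>+x. ennreal ((dist x0 x)\<^sup>2) \<partial>\<mu>) < \<infinity>)}"

definition couplings ::
    "'a::polish_space measure \<Rightarrow> 'a measure \<Rightarrow> ('a \<times> 'a) measure set" where
  "couplings \<mu> \<nu> = {\<pi>. prob_space \<pi> \<and> sets \<pi> = sets borel \<and>
                       distr \<pi> borel fst = \<mu> \<and> distr \<pi> borel snd = \<nu>}"

text \<open>The infimum below is finite whenever both arguments lie in \<open>P2\<close>.\<close>

definition W :: "'a::polish_space measure \<Rightarrow> 'a measure \<Rightarrow> real" where
  "W \<mu> \<nu> = sqrt (enn2real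
     (INF \<pi>\<in>couplings \<mu> \<nu>. \<integral>\<^sup>+z. ennreal ((dist (fst z) (snd z))\<^sup>2) \<partial>\<pi>))"

text \<open>
  The extended integral of a real function, as the difference of the integrals of its positive
  and negative parts. The negative part of \<open>\<rho> log \<rho>\<close> is bounded by \<open>1/e\<close>, so for finite \<open>m\<close>
  (in particular on a compact space) the difference defining the entropy is never of the form
  \<open>\<infinity> - \<infinity>\<close>, nor equal to \<open>-\<infinity>\<close>.
\<close>

definition ext_integral :: "'a measure \<Rightarrow> ('a \<Rightarrow> real) \<Rightarrow> ereal" where
  "ext_integral M f =
     enn2ereal (\<integral>\<^sup>+x. ennreal (f x) \<partial>M) - enn2ereal (\<integral>\<^sup>+x. ennreal (- f x) \<partial>M)"

text \<open>Note that \<open>ln 0 = 0\<close>, so the integrand is \<open>0\<close> where \<open>\<rho> = 0\<close>.\<close>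

definition Ent :: "'a::polish_space measure \<Rightarrow> 'a measure \<Rightarrow> ereal" where
  "Ent m \<mu> =
     (if \<exists>\<rho>\<in>borel_measurable m. \<mu> = density m \<rho>
      then ext_integral m (\<lambda>x. let \<rho> = enn2real (RN_deriv m \<mu> x) in \<rho> * ln \<rho>)
      else \<infinity>)"


section \<open>Metric gradient flows\<close>

text \<open>
  A metric space is given here by a carrier \<open>Y\<close> and a distance \<open>dY\<close>, a curve in \<open>Y\<close> by a function
  on \<^typ>\<open>real\<close> of which only the values at nonnegative times matter.
\<close>

text \<open>
  In \<^typ>\<open>ennreal\<close> the supremum of the empty set is \<open>0\<close>, so the slope vanishes at isolated points.
\<close>

definition descending_slope ::
    "'b set \<Rightarrow> ('b \<Rightarrow> 'b \<Rightarrow> real) \<Rightarrow> ('b \<Rightarrow> ereal) \<Rightarrow> 'b \<Rightarrow> ennreal" where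
  "descending_slope Y dY E y =
     (INF r\<in>{0<..}. SUP z\<in>{z\<in>Y. z \<noteq> y \<and> dY z y < r}.
        e2ennreal (max 0 (- (E z - E y))) / ennreal (dY z y))"

text \<open>For locally absolutely continuous curves the limit exists for almost every \<open>t\<close>.\<close>

definition metric_speed :: "('b \<Rightarrow> 'b \<Rightarrow> real) \<Rightarrow> (real \<Rightarrow> 'b) \<Rightarrow> real \<Rightarrow> real" where
  "metric_speed dY \<mu> t = Lim (at t within {0..}) (\<lambda>s. dY (\<mu> s) (\<mu> t) / \<bar>s - t\<bar>)"

definition abs_cont_curve ::
    "('b \<Rightarrow> 'b \<Rightarrow> real) \<Rightarrow> real \<Rightarrow> real \<Rightarrow> (real \<Rightarrow> 'b) \<Rightarrow> bool" where
  "abs_cont_curve dY a b \<mu> \<longleftrightarrow>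
     (\<exists>g::real \<Rightarrow> real. set_integrable lborel {a..b} g \<and>
        (\<forall>s t. a \<le> s \<and> s \<le> t \<and> t \<le> b \<longrightarrow> dY (\<mu> s) (\<mu> t) \<le> (LINT r:{s..t}|lborel. g r)))"

definition energy_identity ::
    "'b set \<Rightarrow> ('b \<Rightarrow> 'b \<Rightarrow> real) \<Rightarrow> ('b \<Rightarrow> ereal) \<Rightarrow> (real \<Rightarrow> 'b) \<Rightarrow> real \<Rightarrow> real \<Rightarrow> bool" where
  "energy_identity Y dY E \<mu> s t \<longleftrightarrow>
     E (\<mu> s) = E (\<mu> t)
       + enn2ereal (1/2 * (\<integral>\<^sup>+r\<in>{s..t}. ennreal ((metric_speed dY \<mu> r)\<^sup>2) \<partial>lborel))
       + enn2ereal (1/2 * (\<integral>\<^sup>+r\<in>{s..t}. (descending_slope Y dY E (\<mu> r))\<^sup>2 \<partial>lborel))"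

definition metric_gradient_flow ::
    "'b set \<Rightarrow> ('b \<Rightarrow> 'b \<Rightarrow> real) \<Rightarrow> ('b \<Rightarrow> ereal) \<Rightarrow> (real \<Rightarrow> 'b) \<Rightarrow> bool" where
  "metric_gradient_flow Y dY E \<mu> \<longleftrightarrow>
     (\<forall>t\<ge>0. \<mu> t \<in> Y) \<and>
     (if E (\<mu> 0) < \<infinity>
      then (\<forall>b\<ge>0. abs_cont_curve dY 0 b \<mu>) \<and>
           (\<forall>t\<ge>0. energy_identity Y dY E \<mu> 0 t)
      else (\<forall>t\<ge>0. ((\<lambda>s. dY (\<mu> s) (\<mu> t)) \<longlongrightarrow> 0) (at t within {0..})) \<and>
           (\<forall>a b. 0 < a \<and> a \<le> b \<longrightarrow> abs_cont_curve dY a b \<mu>) \<and>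
           (\<forall>t>0. E (\<mu> t) < \<infinity>) \<and>
           (\<forall>s t. 0 < s \<and> s \<le> t \<longrightarrow> energy_identity Y dY E \<mu> s t))"

text \<open>Existence and uniqueness of the flow from \<open>y0\<close>, as a curve on \<open>[0,\<infinity>)\<close>.\<close>

definition unique_gradient_flow_from ::
    "'b set \<Rightarrow> ('b \<Rightarrow> 'b \<Rightarrow> real) \<Rightarrow> ('b \<Rightarrow> ereal) \<Rightarrow> 'b \<Rightarrow> bool" where
  "unique_gradient_flow_from Y dY E y0 \<longleftrightarrow>
     (\<exists>\<mu>. metric_gradient_flow Y dY E \<mu> \<and> \<mu> 0 = y0) \<and>
     (\<forall>\<mu> \<nu>. metric_gradient_flow Y dY E \<mu> \<and> \<mu> 0 = y0 \<and>
            metric_gradient_flow Y dY E \<nu> \<and> \<nu> 0 = y0 \<longrightarrow> (\<forall>t\<ge>0. \<mu> t = \<nu> t))"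

definition gradient_flow_at ::
    "'b set \<Rightarrow> ('b \<Rightarrow> 'b \<Rightarrow> real) \<Rightarrow> ('b \<Rightarrow> ereal) \<Rightarrow> 'b \<Rightarrow> real \<Rightarrow> 'b" where
  "gradient_flow_at Y dY E y0 t =
     (THE y. \<exists>\<mu>. metric_gradient_flow Y dY E \<mu> \<and> \<mu> 0 = y0 \<and> \<mu> t = y)"


section \<open>Heat flow and the functions theta\<close>

definition heat_flow ::
    "'a::polish_space measure \<Rightarrow> real \<Rightarrow> 'a measure \<Rightarrow> 'a measure" where
  "heat_flow m t \<mu> = gradient_flow_at P2 W (Ent m) \<mu> t"

definition dirac :: "'a::polish_space \<Rightarrow> 'a measure" where
  "dirac x = return borel x"

definition dirac_flows_exist_unique :: "'a::polish_space measure \<Rightarrow> bool" where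
  "dirac_flows_exist_unique m \<longleftrightarrow>
     (\<forall>x. unique_gradient_flow_from P2 W (Ent m) (dirac x))"

text \<open>The logarithm of a nonnegative real with \<open>log 0 = -\<infinity>\<close> (whereas \<open>ln 0 = 0\<close>).\<close>

definition ext_ln :: "real \<Rightarrow> ereal" where
  "ext_ln u = (if u = 0 then -\<infinity> else ereal (ln u))"

definition theta_plus :: "'a::polish_space measure \<Rightarrow> 'a \<Rightarrow> 'a \<Rightarrow> ereal" where
  "theta_plus m x y =
     - Liminf (at_right 0) (\<lambda>t::real. ereal (1 / t) *
         ext_ln (W (heat_flow m t (dirac x)) (heat_flow m t (dirac y)) / dist x y))"

text \<open>In \<^typ>\<open>ereal\<close> the supremum of the empty set is \<open>-\<infinity>\<close>, the value at isolated points.\<close>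

definition theta_star :: "'a::polish_space measure \<Rightarrow> 'a \<Rightarrow> ereal" where
  "theta_star m x =
     (INF r\<in>{0<..}. SUP (y, z)\<in>{(y, z). y \<in> ball x r \<and> z \<in> ball x r \<and> y \<noteq> z}.
        theta_plus m y z)"

end

theory Submission
  imports Defs
begin

text \<open>
  An automorphism \<open>\<phi>\<close> of a compact metric measure space has a point \<open>x\<close> that it moves
  the most. The map \<open>\<mu> \<mapsto> \<phi>\<^sub>#\<mu>\<close> is a bijective isometry of \<^term>\<open>P2\<close> that leaves the
  entropy invariant, so it maps gradient flows to gradient flows, and by uniqueness of the flows
  from Dirac measures the heat flow from \<open>dirac (\<phi> x)\<close> is the image of the one from
  \<open>dirac x\<close> (\<open>heat_flow_dirac_equivariant\<close>). Transporting the latter to the former along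
  \<open>\<phi>\<close> itself moves no mass farther than \<open>dist x (\<phi> x)\<close>; hence the two flows never get
  farther apart than they were at time \<open>0\<close>, and \<open>theta_plus m x (\<phi> x) \<ge> 0\<close>
  (\<open>theta_plus_nonneg_at_max_displacement\<close>).

  On the other hand, the negativity of \<^const>\<open>theta_star\<close> and a Lebesgue number of the compact
  space give an \<open>e > 0\<close> such that \<open>theta_plus m y z < 0\<close> whenever \<open>y \<noteq> z\<close> are
  closer than \<open>e\<close>. So the only automorphism that moves all points by less than \<open>e\<close> is the
  identity, which means that distinct automorphisms are at uniform distance at least \<open>e\<close> from
  each other. The set of isometries of a compact space is totally bounded for the uniform
  distance, and a uniformly discrete subset of it is finite
  (\<open>finite_uniformly_discrete_isometries\<close>).
\<close>

section \<open>Gradient flows under symmetries\<close>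

lemma descending_slope_symmetry:
  assumes bij: "bij_betw F Y Y"
    and dist: "\<And>a b. a \<in> Y \<Longrightarrow> b \<in> Y \<Longrightarrow> dY (F a) (F b) = dY a b"
    and E: "\<And>a. a \<in> Y \<Longrightarrow> E (F a) = E a"
    and y: "y \<in> Y"
  shows "descending_slope Y dY E (F y) = descending_slope Y dY E y"
proof -
  have "{z \<in> Y. z \<noteq> F y \<and> dY z (F y) < r} = F ` {z \<in> Y. z \<noteq> y \<and> dY z y < r}" for r
  proof -
    have "{z \<in> F ` Y. z \<noteq> F y \<and> dY z (F y) < r} = F ` {z \<in> Y. F z \<noteq> F y \<and> dY (F z) (F y) < r}"
      by auto
    then have "{z \<in> Y. z \<noteq> F y \<and> dY z (F y) < r} = F ` {z \<in> Y. F z \<noteq> F y \<and> dY (F z) (F y) < r}"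
      using bij by (simp add: bij_betw_def)
    also have "{z \<in> Y. F z \<noteq> F y \<and> dY (F z) (F y) < r} = {z \<in> Y. z \<noteq> y \<and> dY z y < r}"
      using bij y dist by (auto simp: bij_betw_def inj_on_eq_iff)
    finally show ?thesis .
  qed
  then show ?thesis
    unfolding descending_slope_def
    by (auto simp: image_image E dist y intro!: INF_cong SUP_cong)
qed

lemma metric_speed_symmetry:
  assumes dist: "\<And>a b. a \<in> Y \<Longrightarrow> b \<in> Y \<Longrightarrow> dY (F a) (F b) = dY a b"
    and \<mu>: "\<And>t. t \<ge> 0 \<Longrightarrow> \<mu> t \<in> Y" and t: "t \<ge> 0"
  shows "metric_speed dY (\<lambda>t. F (\<mu> t)) t = metric_speed dY \<mu> t"
proof -
  have ev: "\<forall>\<^sub>F s in at t within {0..}.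
      dY (F (\<mu> s)) (F (\<mu> t)) / \<bar>s - t\<bar> = dY (\<mu> s) (\<mu> t) / \<bar>s - t\<bar>"
    unfolding eventually_at_filter by (intro always_eventually) (auto simp: dist \<mu> t)
  show ?thesis
    unfolding metric_speed_def Topological_Spaces.Lim_def by (simp only: tendsto_cong[OF ev])
qed

text \<open>
  Every ingredient of the notion of gradient flow is built from distances between points of
  \<open>Y\<close> and values of \<open>E\<close> on \<open>Y\<close>. The slope is a supremum over all of \<open>Y\<close>, which is
  why \<open>F\<close> has to be onto.
\<close>

lemma metric_gradient_flow_symmetry:
  assumes bij: "bij_betw F Y Y"
    and dist: "\<And>a b. a \<in> Y \<Longrightarrow> b \<in> Y \<Longrightarrow> dY (F a) (F b) = dY a b"
    and E: "\<And>a. a \<in> Y \<Longrightarrow> E (F a) = E a"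
    and flow: "metric_gradient_flow Y dY E \<mu>"
  shows "metric_gradient_flow Y dY E (\<lambda>t. F (\<mu> t))"
proof -
  have \<mu>: "\<mu> t \<in> Y" if "t \<ge> 0" for t
    using flow that by (simp add: metric_gradient_flow_def)
  have F\<mu>: "F (\<mu> t) \<in> Y" if "t \<ge> 0" for t
    using \<mu>[OF that] bij by (auto simp: bij_betw_def)
  have ac: "abs_cont_curve dY a b (\<lambda>t. F (\<mu> t)) \<longleftrightarrow> abs_cont_curve dY a b \<mu>"
    if "a \<ge> 0" for a b
  proof -
    have "dY (F (\<mu> s)) (F (\<mu> t)) = dY (\<mu> s) (\<mu> t)" if "a \<le> s" "s \<le> t" for s t
      using that \<open>a \<ge> 0\<close> by (intro dist \<mu>) auto
    then show ?thesis
      unfolding abs_cont_curve_def by (metis (no_types, lifting))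
  qed
  have en: "energy_identity Y dY E (\<lambda>t. F (\<mu> t)) s t \<longleftrightarrow> energy_identity Y dY E \<mu> s t"
    if "0 \<le> s" "s \<le> t" for s t
  proof -
    have "(\<integral>\<^sup>+r\<in>{s..t}. ennreal ((metric_speed dY (\<lambda>t. F (\<mu> t)) r)\<^sup>2) \<partial>lborel)
        = (\<integral>\<^sup>+r\<in>{s..t}. ennreal ((metric_speed dY \<mu> r)\<^sup>2) \<partial>lborel)"
      using that by (intro nn_integral_cong)
        (auto simp: metric_speed_symmetry[of Y dY F, OF dist \<mu>] indicator_def)
    moreover have "(\<integral>\<^sup>+r\<in>{s..t}. (descending_slope Y dY E (F (\<mu> r)))\<^sup>2 \<partial>lborel)
        = (\<integral>\<^sup>+r\<in>{s..t}. (descending_slope Y dY E (\<mu> r))\<^sup>2 \<partial>lborel)"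
      using that by (intro nn_integral_cong)
        (auto simp: descending_slope_symmetry[of F Y dY E, OF bij dist E \<mu>] indicator_def)
    ultimately show ?thesis
      unfolding energy_identity_def using that by (simp add: E \<mu>)
  qed
  have cont: "((\<lambda>s. dY (F (\<mu> s)) (F (\<mu> t))) \<longlongrightarrow> 0) (at t within {0..}) \<longleftrightarrow>
      ((\<lambda>s. dY (\<mu> s) (\<mu> t)) \<longlongrightarrow> 0) (at t within {0..})" if "t \<ge> 0" for t
    using that by (intro tendsto_cong) (auto simp: eventually_at_filter dist \<mu>)
  show ?thesis
    using flow by (auto simp: metric_gradient_flow_def F\<mu> ac en cont E \<mu>)
qed

lemma gradient_flow_at_eq:
  assumes "unique_gradient_flow_from Y dY E y0"
    and "metric_gradient_flow Y dY E \<mu>" "\<mu> 0 = y0" "t \<ge> 0"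
  shows "gradient_flow_at Y dY E y0 t = \<mu> t"
  unfolding gradient_flow_at_def
  using assms by (intro the_equality) (auto simp: unique_gradient_flow_from_def)


section \<open>Pushing measures forward along isometries\<close>

lemma measurable_isometry:
  fixes \<phi> :: "'a::metric_space \<Rightarrow> 'b::metric_space"
  assumes "\<And>x y. dist (\<phi> x) (\<phi> y) = dist x y"
  shows "\<phi> \<in> borel_measurable borel"
  by (rule borel_measurable_continuous_onI) (auto simp: continuous_on_iff assms)

lemma distr_in_P2:
  fixes \<phi> :: "'a::polish_space \<Rightarrow> 'a"
  assumes iso: "\<And>x y. dist (\<phi> x) (\<phi> y) = dist x y" and \<mu>: "\<mu> \<in> P2"
  shows "distr \<mu> borel \<phi> \<in> P2"
proof -
  note meas [measurable] = measurable_isometry[OF iso]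
  have [measurable_cong]: "sets \<mu> = sets borel"
    using \<mu> by (simp add: P2_def)
  obtain x0 where "(\<integral>\<^sup>+x. ennreal ((dist x0 x)\<^sup>2) \<partial>\<mu>) < \<infinity>"
    using \<mu> by (auto simp: P2_def)
  then have "(\<integral>\<^sup>+x. ennreal ((dist (\<phi> x0) x)\<^sup>2) \<partial>distr \<mu> borel \<phi>) < \<infinity>"
    by (subst nn_integral_distr) (auto simp: iso)
  moreover have "prob_space (distr \<mu> borel \<phi>)"
    using \<mu> by (intro prob_space.prob_space_distr) (auto simp: P2_def)
  ultimately show ?thesis
    by (auto simp: P2_def)
qed

lemma distr_inv_distr:
  assumes "bij \<phi>" and [measurable]: "\<phi> \<in> borel_measurable borel" "inv \<phi> \<in> borel_measurable borel"
    and [measurable_cong]: "sets \<mu> = sets borel"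
  shows "distr (distr \<mu> borel \<phi>) borel (inv \<phi>) = \<mu>"
    and "distr (distr \<mu> borel (inv \<phi>)) borel \<phi> = \<mu>"
proof -
  have "inv \<phi> \<circ> \<phi> = (\<lambda>x. x)" "\<phi> \<circ> inv \<phi> = (\<lambda>x. x)"
    using assms(1) by (auto simp: bij_is_inj bij_is_surj surj_f_inv_f)
  then show "distr (distr \<mu> borel \<phi>) borel (inv \<phi>) = \<mu>"
    and "distr (distr \<mu> borel (inv \<phi>)) borel \<phi> = \<mu>"
    by (simp_all add: distr_distr distr_id2 assms(4))
qed

lemma isometry_inv:
  assumes "bij \<phi>" "\<And>x y. dist (\<phi> x) (\<phi> y) = dist x y"
  shows "dist (inv \<phi> x) (inv \<phi> y) = dist x y"
  by (metis assms bij_inv_eq_iff)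

lemma bij_betw_distr_P2:
  fixes \<phi> :: "'a::polish_space \<Rightarrow> 'a"
  assumes bij: "bij \<phi>" and iso: "\<And>x y. dist (\<phi> x) (\<phi> y) = dist x y"
  shows "bij_betw (\<lambda>\<mu>. distr \<mu> borel \<phi>) P2 P2"
proof -
  note iso' = isometry_inv[OF bij iso]
  have "sets \<mu> = sets borel" if "\<mu> \<in> P2" for \<mu> :: "'a measure"
    using that by (simp add: P2_def)
  then show ?thesis
    by (intro bij_betw_byWitness[where f' = "\<lambda>\<mu>. distr \<mu> borel (inv \<phi>)"])
      (auto simp: distr_inv_distr bij measurable_isometry iso iso' intro!: distr_in_P2)
qed

text \<open>
  Only the infimum inside \<^const>\<open>W\<close> is compared here: it may be infinite, and \<^const>\<open>enn2real\<close>
  is monotone on finite values only.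
\<close>

lemma transport_cost_distr_le:
  fixes \<phi> :: "'a::polish_space \<Rightarrow> 'a"
  assumes iso: "\<And>x y. dist (\<phi> x) (\<phi> y) = dist x y"
  shows "(INF \<pi>\<in>couplings (distr \<mu> borel \<phi>) (distr \<nu> borel \<phi>).
            \<integral>\<^sup>+z. ennreal ((dist (fst z) (snd z))\<^sup>2) \<partial>\<pi>)
       \<le> (INF \<pi>\<in>couplings \<mu> \<nu>. \<integral>\<^sup>+z. ennreal ((dist (fst z) (snd z))\<^sup>2) \<partial>\<pi>)"
proof (rule INF_greatest)
  fix \<pi> assume \<pi>: "\<pi> \<in> couplings \<mu> \<nu>"
  have meas [measurable]: "\<phi> \<in> borel_measurable borel"
    by (rule measurable_isometry[OF iso])
  have proj [measurable]: "fst \<in> borel_measurable (borel :: ('a \<times> 'a) measure)"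
      "snd \<in> borel_measurable (borel :: ('a \<times> 'a) measure)"
    by (auto intro!: borel_measurable_continuous_onI continuous_intros)
  have [measurable_cong]: "sets \<pi> = sets borel"
    using \<pi> by (simp add: couplings_def)
  let ?\<Phi> = "\<lambda>z. (\<phi> (fst z), \<phi> (snd z))"
  have \<Phi> [measurable]: "?\<Phi> \<in> borel_measurable \<pi>"
    unfolding borel_prod[symmetric] by measurable
  have "distr \<mu> borel \<phi> = distr \<pi> borel (\<lambda>z. \<phi> (fst z))"
    "distr \<nu> borel \<phi> = distr \<pi> borel (\<lambda>z. \<phi> (snd z))"
    using \<pi> by (auto simp: couplings_def distr_distr comp_def)
  moreover have "distr (distr \<pi> borel ?\<Phi>) borel fst = distr \<pi> borel (\<lambda>z. \<phi> (fst z))"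
    "distr (distr \<pi> borel ?\<Phi>) borel snd = distr \<pi> borel (\<lambda>z. \<phi> (snd z))"
    by (simp_all add: distr_distr comp_def)
  moreover have "prob_space (distr \<pi> borel ?\<Phi>)"
    using \<pi> by (intro prob_space.prob_space_distr) (auto simp: couplings_def)
  ultimately have mem: "distr \<pi> borel ?\<Phi> \<in> couplings (distr \<mu> borel \<phi>) (distr \<nu> borel \<phi>)"
    by (simp add: couplings_def)
  have "(\<integral>\<^sup>+z. ennreal ((dist (fst z) (snd z))\<^sup>2) \<partial>distr \<pi> borel ?\<Phi>)
      = (\<integral>\<^sup>+z. ennreal ((dist (fst z) (snd z))\<^sup>2) \<partial>\<pi>)"
    by (subst nn_integral_distr) (auto simp: iso)
  then show "(INF \<pi>\<in>couplings (distr \<mu> borel \<phi>) (distr \<nu> borel \<phi>).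
            \<integral>\<^sup>+z. ennreal ((dist (fst z) (snd z))\<^sup>2) \<partial>\<pi>)
       \<le> (\<integral>\<^sup>+z. ennreal ((dist (fst z) (snd z))\<^sup>2) \<partial>\<pi>)"
    using mem by (metis (no_types, lifting) INF_lower)
qed

lemma W_distr_isometry:
  fixes \<phi> :: "'a::polish_space \<Rightarrow> 'a"
  assumes bij: "bij \<phi>" and iso: "\<And>x y. dist (\<phi> x) (\<phi> y) = dist x y"
    and sets: "sets \<mu> = sets borel" "sets \<nu> = sets borel"
  shows "W (distr \<mu> borel \<phi>) (distr \<nu> borel \<phi>) = W \<mu> \<nu>"
proof -
  note iso' = isometry_inv[OF bij iso]
  note inverse = distr_inv_distr(1)[OF bij measurable_isometry[OF iso] measurable_isometry[OF iso']]
  have "(INF \<pi>\<in>couplings (distr \<mu> borel \<phi>) (distr \<nu> borel \<phi>).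
            \<integral>\<^sup>+z. ennreal ((dist (fst z) (snd z))\<^sup>2) \<partial>\<pi>)
       = (INF \<pi>\<in>couplings \<mu> \<nu>. \<integral>\<^sup>+z. ennreal ((dist (fst z) (snd z))\<^sup>2) \<partial>\<pi>)"
    using transport_cost_distr_le[of \<phi> \<mu> \<nu>, OF iso]
      transport_cost_distr_le[of "inv \<phi>" "distr \<mu> borel \<phi>" "distr \<nu> borel \<phi>", OF iso']
    by (intro antisym) (simp_all add: inverse sets)
  then show ?thesis
    by (simp add: W_def)
qed

text \<open>The graph of \<open>\<phi>\<close> carries an admissible coupling of \<open>\<mu>\<close> with its image.\<close>

lemma W_distr_le_displacement:
  fixes \<phi> :: "'a::polish_space \<Rightarrow> 'a"
  assumes [measurable]: "\<phi> \<in> borel_measurable borel"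
    and D: "\<And>y. dist y (\<phi> y) \<le> D"
    and prob: "prob_space \<mu>" and sets [measurable_cong]: "sets \<mu> = sets borel"
  shows "W \<mu> (distr \<mu> borel \<phi>) \<le> D"
proof -
  interpret prob_space \<mu> by fact
  have "D \<ge> 0"
    using D zero_le_dist order_trans by blast
  have proj [measurable]: "fst \<in> borel_measurable (borel :: ('a \<times> 'a) measure)"
      "snd \<in> borel_measurable (borel :: ('a \<times> 'a) measure)"
    by (auto intro!: borel_measurable_continuous_onI continuous_intros)
  let ?G = "\<lambda>x. (x, \<phi> x)"
  have G [measurable]: "?G \<in> borel_measurable \<mu>"
    unfolding borel_prod[symmetric] by measurable
  have mem: "distr \<mu> borel ?G \<in> couplings \<mu> (distr \<mu> borel \<phi>)"
    using sets by (auto simp: couplings_def distr_distr comp_def distr_id2 intro!: prob_space_distr)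
  have "(\<integral>\<^sup>+z. ennreal ((dist (fst z) (snd z))\<^sup>2) \<partial>distr \<mu> borel ?G)
      = (\<integral>\<^sup>+x. ennreal ((dist x (\<phi> x))\<^sup>2) \<partial>\<mu>)"
    by (subst nn_integral_distr) auto
  also have "\<dots> \<le> (\<integral>\<^sup>+x. ennreal (D\<^sup>2) \<partial>\<mu>)"
    by (intro nn_integral_mono ennreal_leI power_mono D) auto
  also have "\<dots> = ennreal (D\<^sup>2)"
    by (simp add: emeasure_space_1)
  finally have "(INF \<pi>\<in>couplings \<mu> (distr \<mu> borel \<phi>).
      \<integral>\<^sup>+z. ennreal ((dist (fst z) (snd z))\<^sup>2) \<partial>\<pi>) \<le> ennreal (D\<^sup>2)"
    using mem by (meson INF_lower2)
  then have "enn2real (INF \<pi>\<in>couplings \<mu> (distr \<mu> borel \<phi>).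
      \<integral>\<^sup>+z. ennreal ((dist (fst z) (snd z))\<^sup>2) \<partial>\<pi>) \<le> D\<^sup>2"
    by (intro enn2real_leI) auto
  then show ?thesis
    unfolding W_def using \<open>D \<ge> 0\<close> by (intro real_le_lsqrt) auto
qed

lemma W_nonneg: "W \<mu> \<nu> \<ge> 0"
  by (simp add: W_def)


section \<open>Invariance of entropy and heat flow under automorphisms\<close>

lemma IsoD:
  assumes "\<phi> \<in> Iso m"
  shows "bij \<phi>" "dist (\<phi> x) (\<phi> y) = dist x y" "distr m borel \<phi> = m"
  using assms by (auto simp: Iso_def)

lemma inv_in_Iso:
  fixes m :: "'a::polish_space measure"
  assumes \<phi>: "\<phi> \<in> Iso m" and sets: "sets m = sets borel"
  shows "inv \<phi> \<in> Iso m"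
proof -
  note bij = IsoD(1)[OF \<phi>] and iso = IsoD(2)[OF \<phi>]
  note iso' = isometry_inv[OF bij iso]
  have "distr (distr m borel \<phi>) borel (inv \<phi>) = m"
    by (intro distr_inv_distr bij measurable_isometry iso iso' sets)
  then show ?thesis
    using bij iso' by (simp add: Iso_def IsoD(3)[OF \<phi>] bij_imp_bij_inv)
qed

lemma comp_in_Iso:
  fixes m :: "'a::polish_space measure"
  assumes \<phi>: "\<phi> \<in> Iso m" and \<psi>: "\<psi> \<in> Iso m" and sets: "sets m = sets borel"
  shows "\<phi> \<circ> \<psi> \<in> Iso m"
proof -
  have [measurable]: "\<phi> \<in> borel_measurable borel" "\<psi> \<in> borel_measurable borel"
    using IsoD(2)[OF \<phi>] IsoD(2)[OF \<psi>] by (auto intro: measurable_isometry)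
  have [measurable_cong]: "sets m = sets borel"
    by fact
  have "distr m borel (\<phi> \<circ> \<psi>) = distr (distr m borel \<psi>) borel \<phi>"
    by (rule distr_distr[symmetric]) auto
  then show ?thesis
    using \<phi> \<psi> by (auto simp: Iso_def bij_comp)
qed

text \<open>
  The density of \<open>\<phi>\<^sub>#\<mu>\<close> at \<open>\<phi> x\<close> is that of \<open>\<mu>\<close> at \<open>x\<close>, because \<open>\<phi>\<close> preserves the
  reference measure.
\<close>

lemma Ent_distr_Iso:
  fixes m :: "'a::polish_space measure"
  assumes m: "metric_measure_space m" and \<phi>: "\<phi> \<in> Iso m" and sets\<mu>: "sets \<mu> = sets borel"
  shows "Ent m (distr \<mu> borel \<phi>) = Ent m \<mu>"
proof -
  have setsm [measurable_cong]: "sets m = sets borel" and "sigma_finite_measure m"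
    using m by (auto simp: metric_measure_space_def)
  interpret sigma_finite_measure m by fact
  note bij = IsoD(1)[OF \<phi>] and iso = IsoD(2)[OF \<phi>] and pres = IsoD(3)[OF \<phi>]
  have meas [measurable]: "\<phi> \<in> borel_measurable borel" "inv \<phi> \<in> borel_measurable borel"
    using iso isometry_inv[OF bij iso] by (auto intro: measurable_isometry)
  have inv [simp]: "inv \<phi> (\<phi> x) = x" for x
    using bij by (simp add: bij_is_inj)
  have push: "distr (density m \<rho>) borel \<phi> = density m (\<lambda>x. \<rho> (inv \<phi> x))"
    if [measurable]: "\<rho> \<in> borel_measurable m" for \<rho> :: "'a \<Rightarrow> ennreal"
  proof -
    have [measurable]: "\<rho> \<in> borel_measurable borel"
      using that setsm by (simp cong: measurable_cong_sets)
    have "density m (\<lambda>x. \<rho> (inv \<phi> x)) = density (distr m borel \<phi>) (\<lambda>x. \<rho> (inv \<phi> x))"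
      by (simp add: pres)
    also have "\<dots> = distr (density m (\<lambda>x. \<rho> (inv \<phi> (\<phi> x)))) borel \<phi>"
      by (intro density_distr) measurable
    finally show ?thesis by simp
  qed
  show ?thesis
  proof (cases "\<exists>\<rho>\<in>borel_measurable m. \<mu> = density m \<rho>")
    case True
    then obtain \<rho> where \<rho>: "\<rho> \<in> borel_measurable m" "\<mu> = density m \<rho>"
      by blast
    have \<rho>b [measurable]: "\<rho> \<in> borel_measurable borel"
      using \<rho>(1) setsm by (simp cong: measurable_cong_sets)
    let ?\<rho>' = "\<lambda>x. \<rho> (inv \<phi> x)"
    have \<rho>': "?\<rho>' \<in> borel_measurable m" by measurable
    have eq: "distr \<mu> borel \<phi> = density m ?\<rho>'"
      using push \<rho> by simp
    define h where "h = (\<lambda>r::ennreal. enn2real r * ln (enn2real r))"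
    have [measurable]: "h \<in> borel_measurable borel"
      unfolding h_def by measurable
    have rn: "AE x in m. RN_deriv m \<mu> x = \<rho> x"
      using RN_deriv_unique[OF \<rho>(1)] \<rho>(2) by (auto simp: eq_commute)
    have rn': "AE x in m. RN_deriv m (distr \<mu> borel \<phi>) x = ?\<rho>' x"
      using RN_deriv_unique[OF \<rho>'] eq by (auto simp: eq_commute)
    have cv: "(\<integral>\<^sup>+x. g (RN_deriv m (distr \<mu> borel \<phi>) x) \<partial>m) = (\<integral>\<^sup>+x. g (RN_deriv m \<mu> x) \<partial>m)"
      if [measurable]: "g \<in> borel_measurable borel" for g :: "ennreal \<Rightarrow> ennreal"
    proof -
      have "(\<integral>\<^sup>+x. g (RN_deriv m (distr \<mu> borel \<phi>) x) \<partial>m) = (\<integral>\<^sup>+x. g (?\<rho>' x) \<partial>m)"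
        using rn' by (intro nn_integral_cong_AE) auto
      also have "\<dots> = (\<integral>\<^sup>+x. g (?\<rho>' x) \<partial>distr m borel \<phi>)"
        by (simp add: pres)
      also have "\<dots> = (\<integral>\<^sup>+x. g (\<rho> x) \<partial>m)"
        by (subst nn_integral_distr) auto
      also have "\<dots> = (\<integral>\<^sup>+x. g (RN_deriv m \<mu> x) \<partial>m)"
        using rn by (intro nn_integral_cong_AE) auto
      finally show ?thesis .
    qed
    have "ext_integral m (\<lambda>x. h (RN_deriv m (distr \<mu> borel \<phi>) x))
        = ext_integral m (\<lambda>x. h (RN_deriv m \<mu> x))"
      unfolding ext_integral_def
      using cv[of "\<lambda>r. ennreal (h r)"] cv[of "\<lambda>r. ennreal (- h r)"] by simp
    moreover have "\<exists>\<rho>\<in>borel_measurable m. distr \<mu> borel \<phi> = density m \<rho>"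
      using eq \<rho>' by blast
    ultimately show ?thesis
      using True by (simp add: Ent_def h_def Let_def)
  next
    case False
    have "\<not> (\<exists>\<rho>\<in>borel_measurable m. distr \<mu> borel \<phi> = density m \<rho>)"
    proof
      assume "\<exists>\<rho>\<in>borel_measurable m. distr \<mu> borel \<phi> = density m \<rho>"
      then obtain \<rho> where \<rho>: "\<rho> \<in> borel_measurable m" "distr \<mu> borel \<phi> = density m \<rho>"
        by blast
      have \<rho>b [measurable]: "\<rho> \<in> borel_measurable borel"
        using \<rho>(1) setsm by (simp cong: measurable_cong_sets)
      have surj: "\<phi> (inv \<phi> x) = x" for x
        using bij by (simp add: bij_is_surj surj_f_inv_f)
      have comp: "(\<lambda>x. \<rho> (\<phi> x)) \<in> borel_measurable m"
        by measurable
      have "distr (density m (\<lambda>x. \<rho> (\<phi> x))) borel \<phi> = distr \<mu> borel \<phi>"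
        using push[OF comp] \<rho>(2) by (simp add: surj)
      then have "distr (distr (density m (\<lambda>x. \<rho> (\<phi> x))) borel \<phi>) borel (inv \<phi>)
          = distr (distr \<mu> borel \<phi>) borel (inv \<phi>)"
        by simp
      then have "density m (\<lambda>x. \<rho> (\<phi> x)) = \<mu>"
        by (simp add: distr_inv_distr bij meas sets\<mu> setsm)
      then show False
        using False comp by blast
    qed
    then show ?thesis
      using False by (simp add: Ent_def)
  qed
qed

lemma distr_dirac:
  assumes "\<phi> \<in> borel_measurable borel"
  shows "distr (dirac x) borel \<phi> = dirac (\<phi> x)"
  using assms by (simp add: dirac_def distr_return)

lemma heat_flow_dirac_in_P2:
  assumes "dirac_flows_exist_unique m" "t \<ge> 0"
  shows "heat_flow m t (dirac x) \<in> P2"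
proof -
  obtain \<mu> where \<mu>: "metric_gradient_flow P2 W (Ent m) \<mu>" "\<mu> 0 = dirac x"
    using assms(1) unfolding dirac_flows_exist_unique_def unique_gradient_flow_from_def by blast
  then have "heat_flow m t (dirac x) = \<mu> t"
    using assms unfolding heat_flow_def dirac_flows_exist_unique_def
    by (intro gradient_flow_at_eq) auto
  then show ?thesis
    using \<mu>(1) assms(2) by (simp add: metric_gradient_flow_def)
qed

lemma heat_flow_dirac_equivariant:
  fixes m :: "'a::polish_space measure"
  assumes m: "metric_measure_space m" and ex: "dirac_flows_exist_unique m"
    and \<phi>: "\<phi> \<in> Iso m" and t: "t \<ge> 0"
  shows "heat_flow m t (dirac (\<phi> x)) = distr (heat_flow m t (dirac x)) borel \<phi>"
proof -
  note bij = IsoD(1)[OF \<phi>] and iso = IsoD(2)[OF \<phi>]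
  have unique: "unique_gradient_flow_from P2 W (Ent m) (dirac y)" for y
    using ex by (simp add: dirac_flows_exist_unique_def)
  obtain \<mu> where \<mu>: "metric_gradient_flow P2 W (Ent m) \<mu>" "\<mu> 0 = dirac x"
    using unique[of x] unfolding unique_gradient_flow_from_def by blast
  have "metric_gradient_flow P2 W (Ent m) (\<lambda>t. distr (\<mu> t) borel \<phi>)"
    by (rule metric_gradient_flow_symmetry[OF bij_betw_distr_P2[OF bij iso] _ _ \<mu>(1)])
      (auto simp: P2_def intro!: W_distr_isometry bij iso Ent_distr_Iso m \<phi>)
  moreover have "distr (\<mu> 0) borel \<phi> = dirac (\<phi> x)"
    by (simp add: \<mu>(2) distr_dirac measurable_isometry iso)
  ultimately have "heat_flow m t (dirac (\<phi> x)) = distr (\<mu> t) borel \<phi>"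
    unfolding heat_flow_def
    using gradient_flow_at_eq[OF unique _ _ t, where \<mu> = "\<lambda>t. distr (\<mu> t) borel \<phi>"] by blast
  moreover have "heat_flow m t (dirac x) = \<mu> t"
    unfolding heat_flow_def using gradient_flow_at_eq[OF unique \<mu> t] .
  ultimately show ?thesis by simp
qed


section \<open>Automorphisms close to the identity\<close>

text \<open>
  If the two heat flows never get farther apart than their starting points, the logarithms in
  the definition of \<^const>\<open>theta_plus\<close> are all nonpositive.
\<close>

lemma theta_plus_nonneg_of_W_le:
  assumes W: "\<And>t. t > 0 \<Longrightarrow> W (heat_flow m t (dirac x)) (heat_flow m t (dirac y)) \<le> dist x y"
  shows "theta_plus m x y \<ge> 0"
proof -
  have "ereal (1 / t) *
      ext_ln (W (heat_flow m t (dirac x)) (heat_flow m t (dirac y)) / dist x y) \<le> 0"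
    if t: "t > 0" for t
  proof -
    let ?u = "W (heat_flow m t (dirac x)) (heat_flow m t (dirac y)) / dist x y"
    have "ext_ln u \<le> 0" if "0 \<le> u" "u \<le> 1" for u
      using that by (cases "u = 0") (simp_all add: ext_ln_def)
    moreover have "0 \<le> ?u"
      by (simp add: W_nonneg)
    moreover have "?u \<le> 1"
      using W[OF t] by (simp add: divide_le_eq_1)
    ultimately have "ext_ln ?u \<le> 0"
      by blast
    then show ?thesis
      using t by (simp add: ereal_mult_le_0_iff)
  qed
  then have "\<forall>\<^sub>F t in at_right 0. ereal (1 / t) *
      ext_ln (W (heat_flow m t (dirac x)) (heat_flow m t (dirac y)) / dist x y) \<le> 0"
    by (auto simp: eventually_at_filter)
  then have "Liminf (at_right 0) (\<lambda>t::real. ereal (1 / t) *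
      ext_ln (W (heat_flow m t (dirac x)) (heat_flow m t (dirac y)) / dist x y))
      \<le> Liminf (at_right 0) (\<lambda>t::real. 0)"
    by (rule Liminf_mono)
  then show ?thesis
    by (simp add: theta_plus_def Liminf_const ereal_0_le_uminus_iff)
qed

text \<open>
  The coupling along \<open>\<phi>\<close> may move mass anywhere in the space, so \<open>x\<close> has to maximise the
  displacement globally for the cost to be at most \<open>dist x (\<phi> x)\<close> at every time.
\<close>

lemma theta_plus_nonneg_at_max_displacement:
  fixes m :: "'a::polish_space measure"
  assumes m: "metric_measure_space m" and ex: "dirac_flows_exist_unique m"
    and \<phi>: "\<phi> \<in> Iso m" and max: "\<And>y. dist y (\<phi> y) \<le> dist x (\<phi> x)"
  shows "theta_plus m x (\<phi> x) \<ge> 0"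
proof (rule theta_plus_nonneg_of_W_le)
  fix t :: real assume "t > 0"
  then have "heat_flow m t (dirac x) \<in> P2"
    by (intro heat_flow_dirac_in_P2 ex) simp
  then have "W (heat_flow m t (dirac x)) (distr (heat_flow m t (dirac x)) borel \<phi>)
      \<le> dist x (\<phi> x)"
    by (intro W_distr_le_displacement max measurable_isometry IsoD(2)[OF \<phi>])
      (auto simp: P2_def)
  then show "W (heat_flow m t (dirac x)) (heat_flow m t (dirac (\<phi> x))) \<le> dist x (\<phi> x)"
    using heat_flow_dirac_equivariant[OF m ex \<phi>] \<open>t > 0\<close> by simp
qed

lemma theta_plus_neg_uniformly:
  fixes m :: "'a::polish_space measure"
  assumes compact: "compact (UNIV :: 'a set)" and neg: "\<forall>x. theta_star m x < 0"
  obtains e where "e > 0" "\<And>y z. y \<noteq> z \<Longrightarrow> dist y z < e \<Longrightarrow> theta_plus m y z < 0"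
proof -
  have "\<exists>r>0. \<forall>y\<in>ball x r. \<forall>z\<in>ball x r. y \<noteq> z \<longrightarrow> theta_plus m y z < 0" for x
  proof -
    obtain r where "r > 0"
      and r: "(SUP (y, z)\<in>{(y, z). y \<in> ball x r \<and> z \<in> ball x r \<and> y \<noteq> z}. theta_plus m y z) < 0"
      using neg[rule_format, of x] unfolding theta_star_def INF_less_iff by auto
    have "theta_plus m y z < 0" if "y \<in> ball x r" "z \<in> ball x r" "y \<noteq> z" for y z
      using le_less_trans[OF SUP_upper r, of "(y, z)"] that by simp
    with \<open>r > 0\<close> show ?thesis by blast
  qed
  then obtain r where pos: "\<And>x. r x > 0"
    and r: "\<And>x y z. y \<in> ball x (r x) \<Longrightarrow> z \<in> ball x (r x) \<Longrightarrow> y \<noteq> z \<Longrightarrow> theta_plus m y z < 0"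
    by metis
  have cover: "(UNIV :: 'a set) \<subseteq> \<Union> (range (\<lambda>x. ball x (r x)))"
    using pos by auto
  obtain e where "e > 0" and e: "\<And>x. \<exists>G\<in>range (\<lambda>x. ball x (r x)). ball x e \<subseteq> G"
    by (rule Heine_Borel_lemma[OF compact cover]) (blast intro: open_ball that)+
  show thesis
  proof
    fix y z :: 'a assume "y \<noteq> z" and "dist y z < e"
    obtain x where "ball y e \<subseteq> ball x (r x)"
      using e[of y] by auto
    moreover have "y \<in> ball y e" "z \<in> ball y e"
      using \<open>e > 0\<close> \<open>dist y z < e\<close> by auto
    ultimately show "theta_plus m y z < 0"
      using r \<open>y \<noteq> z\<close> by blast
  qed fact
qed

lemma Iso_near_id_eq_id:
  fixes m :: "'a::polish_space measure"
  assumes m: "metric_measure_space m" and compact: "compact (UNIV :: 'a set)"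
    and ex: "dirac_flows_exist_unique m"
    and neg: "\<And>y z. y \<noteq> z \<Longrightarrow> dist y z < e \<Longrightarrow> theta_plus m y z < 0"
    and \<phi>: "\<phi> \<in> Iso m" and near: "\<And>x. dist x (\<phi> x) < e"
  shows "\<phi> x = x"
proof -
  have "continuous_on UNIV \<phi>"
    by (auto simp: continuous_on_iff IsoD(2)[OF \<phi>])
  then have "continuous_on UNIV (\<lambda>x. dist x (\<phi> x))"
    by (intro continuous_intros)
  then obtain x0 where max: "\<And>y. dist y (\<phi> y) \<le> dist x0 (\<phi> x0)"
    using continuous_attains_sup[OF compact] by auto
  have "x0 = \<phi> x0"
    using theta_plus_nonneg_at_max_displacement[OF m ex \<phi> max] neg[of x0 "\<phi> x0"] near[of x0]
    by (meson leD)
  then show ?thesis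
    using max[of x] by simp
qed


section \<open>Finiteness\<close>

text \<open>
  An isometry is determined up to uniform distance \<open>e\<close> by the nearby net points of the
  images of the points of a finite \<open>e / 4\<close>-net, and there are finitely many such data.
\<close>

lemma finite_uniformly_discrete_isometries:
  fixes I :: "('a::metric_space \<Rightarrow> 'a) set"
  assumes compact: "compact (UNIV :: 'a set)" and "e > 0"
    and iso: "\<And>\<phi> x y. \<phi> \<in> I \<Longrightarrow> dist (\<phi> x) (\<phi> y) = dist x y"
    and discrete: "\<And>\<phi> \<psi>. \<phi> \<in> I \<Longrightarrow> \<psi> \<in> I \<Longrightarrow> (\<And>x. dist (\<phi> x) (\<psi> x) < e) \<Longrightarrow> \<phi> = \<psi>"
  shows "finite I"
proof -
  obtain N :: "'a set" where "finite N" and "UNIV \<subseteq> (\<Union>p\<in>N. ball p (e / 4))"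
    using compact \<open>e > 0\<close> unfolding compact_eq_totally_bounded
    by (metis divide_pos_pos zero_less_numeral)
  then have "\<forall>x. \<exists>p\<in>N. dist p x < e / 4"
    by (auto simp: subset_iff)
  then obtain c where c: "\<And>x. c x \<in> N" "\<And>x. dist (c x) x < e / 4"
    by metis
  have "inj_on (\<lambda>\<phi>. \<lambda>p\<in>N. c (\<phi> p)) I"
  proof (intro inj_onI discrete)
    fix \<phi> \<psi> x
    assume \<phi>: "\<phi> \<in> I" and \<psi>: "\<psi> \<in> I" and eq: "(\<lambda>p\<in>N. c (\<phi> p)) = (\<lambda>p\<in>N. c (\<psi> p))"
    let ?p = "c x"
    have "c (\<phi> ?p) = c (\<psi> ?p)"
      using fun_cong[OF eq, of ?p] c(1) by simp
    then have "dist (\<phi> ?p) (\<psi> ?p) < e / 4 + e / 4"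
      using c(2)[of "\<phi> ?p"] c(2)[of "\<psi> ?p"]
      by (metis add_strict_mono dist_commute dist_triangle le_less_trans)
    moreover have "dist (\<phi> x) (\<phi> ?p) < e / 4" "dist (\<psi> ?p) (\<psi> x) < e / 4"
      using c(2)[of x] by (simp_all add: iso \<phi> \<psi> dist_commute)
    moreover have "dist (\<phi> x) (\<psi> x) \<le> dist (\<phi> x) (\<phi> ?p) + (dist (\<phi> ?p) (\<psi> ?p) + dist (\<psi> ?p) (\<psi> x))"
      by (meson add_left_mono dist_triangle order_trans)
    ultimately show "dist (\<phi> x) (\<psi> x) < e"
      by simp
  qed
  moreover have "(\<lambda>\<phi>. \<lambda>p\<in>N. c (\<phi> p)) ` I \<subseteq> N \<rightarrow>\<^sub>E N"
    using c(1) by auto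
  moreover have "finite (N \<rightarrow>\<^sub>E N)"
    using \<open>finite N\<close> by (intro finite_PiE) auto
  ultimately show ?thesis
    by (rule inj_on_finite)
qed

theorem theorem1p3:
  fixes m :: "'a::polish_space measure"
  assumes "metric_measure_space m"
    and "compact (UNIV :: 'a set)"
    and "dirac_flows_exist_unique m"
    and "\<forall>x. theta_star m x < 0"
  shows "finite (Iso m)"
proof -
  have sets: "sets m = sets borel"
    using assms(1) by (simp add: metric_measure_space_def)
  obtain e where "e > 0"
    and neg: "\<And>y z. y \<noteq> z \<Longrightarrow> dist y z < e \<Longrightarrow> theta_plus m y z < 0"
    using theta_plus_neg_uniformly[OF assms(2,4)] by blast
  show ?thesis
  proof (rule finite_uniformly_discrete_isometries[OF assms(2) \<open>e > 0\<close>])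
    fix \<phi> \<psi> assume \<phi>: "\<phi> \<in> Iso m" and \<psi>: "\<psi> \<in> Iso m"
      and near: "\<And>x. dist (\<phi> x) (\<psi> x) < e"
    have inv\<psi>: "inv \<psi> \<circ> \<phi> \<in> Iso m"
      by (intro comp_in_Iso inv_in_Iso \<phi> \<psi> sets)
    have \<psi>_inv: "\<psi> (inv \<psi> y) = y" for y
      using IsoD(1)[OF \<psi>] by (simp add: bij_is_surj surj_f_inv_f)
    have "dist x ((inv \<psi> \<circ> \<phi>) x) < e" for x
      using near[of x] IsoD(2)[OF \<psi>, of x "inv \<psi> (\<phi> x)"] by (simp add: \<psi>_inv dist_commute)
    then have "inv \<psi> (\<phi> x) = x" for x
      using Iso_near_id_eq_id[where e = e, OF assms(1-3) _ inv\<psi>] neg by simp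
    then show "\<phi> = \<psi>"
      by (metis \<psi>_inv ext)
  qed (rule IsoD(2))
qed

end
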